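(* Let $\alpha\in(0,1)$ and let $F:\mathbb{R}^n\to\mathbb{R}^n$ be a continuous $\alpha$-averaged operator such that $\mathcal{F}_F\neq\emptyset$ and such that, for some $R>0$, the following error-bound condition holds: there exists $K_F>0$ such that, for all $x\in\mathbb{R}^n$, $$\operatorname{dist}(x,\mathcal{F}_F)\le R \ \text{ implies } \ \operatorname{dist}(x,\mathcal{F}_F)\le K_F\,\|F(x)-x\|.$$ Let $x_0\in\mathbb{R}^n$ be given and let $x_{k+1}=F(x_k)$ for $k=0,1,\dots$. Then $x_k\to\bar x\in\mathcal{F}_F$ linearly. In particular, for any $k\ge 0$ such that $\operatorname{dist}(x_k,\mathcal{F}_F)\le R$, $$\operatorname{dist}(x_{k+1},\mathcal{F}_F)\le\rho\,\operatorname{dist}(x_k,\mathcal{F}_F),\quad\text{where } \rho:=\left(1-\tfrac{1-\alpha}{\alpha K_F^2}\right)^{1/2}\le 1-\tfrac{1-\alpha}{2\alpha K_F^2},$$ and $$\|x_{k+1}-\bar x\|\le\hat\rho\,\|x_k-\bar x\|,\quad\text{where } \hat\rho:=\left(1-\tfrac{1+\rho}{2}(1-\rho)^2\right)^{1/2}\le 1-\tfrac{(1-\alpha)^2}{16\alpha^2K_F^4}.$$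
   Context: $\|\cdot\|$ is the Euclidean norm and $\operatorname{dist}(x,S)=\inf_{y\in S}\|x-y\|$. For an operator $F:\mathbb{R}^n\to\mathbb{R}^n$, $\mathcal{F}_F:=\{x\in\mathbb{R}^n: F(x)=x\}$ is its set of fixed points. An operator $N:\mathbb{R}^n\to\mathbb{R}^n$ is nonexpansive if $\|N(x)-N(y)\|\le\|x-y\|$ for all $x,y\in\mathbb{R}^n$. For $\alpha\in(0,1)$, $F$ is $\alpha$-averaged if $F(x)=(1-\alpha)x+\alpha N(x)$ for all $x$, for some nonexpansive operator $N$. A sequence $x_k$ converges linearly to $\bar x$ if $x_k\to\bar x$ and there are $q\in[0,1)$ and $k_0$ such that $\|x_{k+1}-\bar x\|\le q\|x_k-\bar x\|$ for all $k\ge k_0$.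
   Formalization: The closed-form upper bounds on ρ and ρ̂ are stated only when 1−(1−α)/(αK_F²) ≥ 0; this is proved for every F other than the identity, while for F = id the error bound holds for every K_F > 0 and ρ may fail to be real. *)

theory Defs
  imports "HOL-Analysis.Analysis"
begin

definition fixed_points :: "('a \<Rightarrow> 'a) \<Rightarrow> 'a set" where
  "fixed_points F = {x. F x = x}"

definition nonexpansive :: "('a::real_normed_vector \<Rightarrow> 'a) \<Rightarrow> bool" where
  "nonexpansive N \<longleftrightarrow> (\<forall>x y. norm (N x - N y) \<le> norm (x - y))"

definition averaged :: "real \<Rightarrow> ('a::real_normed_vector \<Rightarrow> 'a) \<Rightarrow> bool" where
  "averaged \<alpha> F \<longleftrightarrow>
     (\<exists>N. nonexpansive N \<and> (\<forall>x. F x = (1 - \<alpha>) *\<^sub>R x + \<alpha> *\<^sub>R N x))"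

definition converges_linearly :: "(nat \<Rightarrow> 'a::real_normed_vector) \<Rightarrow> 'a \<Rightarrow> bool" where
  "converges_linearly x xbar \<longleftrightarrow>
     x \<longlonglongrightarrow> xbar \<and>
     (\<exists>q k0. 0 \<le> q \<and> q < 1 \<and>
        (\<forall>k\<ge>k0. norm (x (Suc k) - xbar) \<le> q * norm (x k - xbar)))"

text \<open>
  The library's \<open>infdist\<close> of a point to the empty set is 0 by convention; the condition below
  is meant for operators with at least one fixed point.
\<close>

definition error_bound :: "('a::real_normed_vector \<Rightarrow> 'a) \<Rightarrow> real \<Rightarrow> real \<Rightarrow> bool" where
  "error_bound F R K \<longleftrightarrow>
     (\<forall>x. infdist x (fixed_points F) \<le> R \<longrightarrow>
          infdist x (fixed_points F) \<le> K * norm (F x - x))"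

text \<open>
  The rate \<open>\<rho> = sqrt (1 - (1 - \<alpha>) / (\<alpha> * K\<^sup>2))\<close> is a real root only if the radicand is
  nonnegative. That follows from the error bound when \<open>F\<close> is not the identity; the identity satisfies
  the error bound for every \<open>K > 0\<close>, and then the radicand can be negative. The closed-form bounds on
  the rates are therefore stated whenever the radicand is nonnegative, which is itself asserted for
  every \<open>F\<close> other than the identity.
\<close>

end

theory Submission imports Defs
begin

text \<open>
  An averaged operator does more than not increase the distance to a fixed point \<open>z\<close>: with
  \<open>c = (1 - \<alpha>) / \<alpha>\<close> it satisfies
  \<open>\<parallel>F y - z\<parallel>\<^sup>2 + c \<parallel>F y - y\<parallel>\<^sup>2 \<le> \<parallel>y - z\<parallel>\<^sup>2\<close>
  (\<open>averaged_sufficient_decrease\<close>), and everything below is extracted from this inequality.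

  Convergence is the classical Krasnoselskii--Mann argument (\<open>sufficient_decrease_iterates_converge\<close>):
  the decrements telescope, so the residuals \<open>F x\<^sub>k - x\<^sub>k\<close> vanish; the orbit is bounded, so it has a
  cluster point, which is fixed by continuity; and the distance to that fixed point is monotone, so
  the whole orbit converges to it.

  For the rates, let \<open>d\<close> be the distance of \<open>y\<close> to the fixed points, attained at \<open>z\<close>. If \<open>d \<le> R\<close>, the
  error bound \<open>d \<le> K \<parallel>F y - y\<parallel>\<close> turns the decrease into \<open>\<parallel>F y - z\<parallel>\<^sup>2 \<le> (1 - c / K\<^sup>2) d\<^sup>2 = \<rho>\<^sup>2 d\<^sup>2\<close>
  (\<open>error_bound_contracts_to_nearest\<close>). This is the contraction of the distance.
  It also controls the limit: later iterates come no farther from \<open>z\<close>, so the limit \<open>p\<close> of the orbit of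
  \<open>y\<close> has \<open>\<parallel>p - z\<parallel> \<le> \<rho> d\<close>, whence \<open>\<parallel>y - p\<parallel> \<le> (1 + \<rho>) d\<close>. Thus the guaranteed decrease
  \<open>c \<parallel>F y - y\<parallel>\<^sup>2 \<ge> (1 - \<rho>\<^sup>2) d\<^sup>2\<close> is at least a fixed multiple of \<open>\<parallel>y - p\<parallel>\<^sup>2\<close>, and the distance to
  \<open>p\<close> contracts as well; the factor in the theorem comes from \<open>(1 + \<rho>)\<^sup>2 (1 - \<rho>) \<le> 2\<close>.

  If \<open>F\<close> is the identity, the orbit is constant and there is nothing to estimate. Otherwise there are
  points at positive distance at most \<open>R\<close> from the fixed points, and at such a point the squared
  contraction inequality forces the radicand \<open>1 - c / K\<^sup>2\<close> to be nonnegative.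
\<close>

section \<open>Sufficient decrease\<close>

definition sufficient_decrease :: "real \<Rightarrow> ('a::real_normed_vector \<Rightarrow> 'a) \<Rightarrow> bool" where
  "sufficient_decrease c F \<longleftrightarrow>
     (\<forall>y. \<forall>z\<in>fixed_points F. (norm (F y - z))^2 + c * (norm (F y - y))^2 \<le> (norm (y - z))^2)"

lemma sufficient_decreaseD:
  "sufficient_decrease c F \<Longrightarrow> z \<in> fixed_points F \<Longrightarrow>
     (norm (F y - z))^2 + c * (norm (F y - y))^2 \<le> (norm (y - z))^2"
  by (simp add: sufficient_decrease_def)

lemma sufficient_decrease_norm_le:
  assumes "sufficient_decrease c F" "0 \<le> c" "z \<in> fixed_points F"
  shows "norm (F y - z) \<le> norm (y - z)"
proof -
  have "0 \<le> c * (norm (F y - y))^2"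
    using assms(2) by simp
  then have "(norm (F y - z))^2 \<le> (norm (y - z))^2"
    using sufficient_decreaseD[OF assms(1,3), of y] by linarith
  then show ?thesis
    by (rule power2_le_imp_le) simp
qed

text \<open>
  Strict convexity of the squared Euclidean norm, in the form of an identity.
\<close>

lemma norm_convex_combination_squared:
  fixes u v :: "'a::real_inner"
  shows "(norm ((1 - t) *\<^sub>R u + t *\<^sub>R v))^2
       = (1 - t) * (norm u)^2 + t * (norm v)^2 - t * (1 - t) * (norm (v - u))^2"
  by (simp add: power2_norm_eq_inner inner_simps inner_commute[of v u] algebra_simps)

text \<open>
  With \<open>z\<close> fixed, \<open>F y - z\<close> is the convex combination of \<open>y - z\<close> and the no longer vector \<open>N y - z\<close>;
  the loss term of the preceding identity is a multiple of \<open>\<parallel>N y - y\<parallel>\<^sup>2 = \<parallel>F y - y\<parallel>\<^sup>2 / \<alpha>\<^sup>2\<close>.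
\<close>

lemma averaged_sufficient_decrease:
  fixes F :: "'a::real_inner \<Rightarrow> 'a"
  assumes "averaged \<alpha> F" "0 < \<alpha>"
  shows "sufficient_decrease ((1 - \<alpha>) / \<alpha>) F"
  unfolding sufficient_decrease_def
proof (intro allI ballI)
  fix y z assume z: "z \<in> fixed_points F"
  obtain N where N: "nonexpansive N" and F: "\<And>x. F x = (1 - \<alpha>) *\<^sub>R x + \<alpha> *\<^sub>R N x"
    using assms(1) unfolding averaged_def by blast
  have "\<alpha> *\<^sub>R (N z - z) = F z - z"
    by (simp add: F algebra_simps)
  then have Nz: "N z = z"
    using z assms(2) by (simp add: fixed_points_def)
  have "F y - z = (1 - \<alpha>) *\<^sub>R (y - z) + \<alpha> *\<^sub>R (N y - z)"
    by (simp add: F algebra_simps)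
  then have split: "(norm (F y - z))^2
      = (1 - \<alpha>) * (norm (y - z))^2 + \<alpha> * (norm (N y - z))^2 - \<alpha> * (1 - \<alpha>) * (norm (N y - y))^2"
    using norm_convex_combination_squared[of \<alpha> "y - z" "N y - z"] by simp
  have "norm (N y - z) \<le> norm (y - z)"
    using N Nz unfolding nonexpansive_def by metis
  then have N_le: "\<alpha> * (norm (N y - z))^2 \<le> \<alpha> * (norm (y - z))^2"
    using assms(2) by (simp add: power_mono)
  have "F y - y = \<alpha> *\<^sub>R (N y - y)"
    by (simp add: F algebra_simps)
  then have "norm (F y - y) = \<alpha> * norm (N y - y)"
    using assms(2) by simp
  then have "(1 - \<alpha>) / \<alpha> * (norm (F y - y))^2 = \<alpha> * (1 - \<alpha>) * (norm (N y - y))^2"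
    using assms(2) by (simp add: power_mult_distrib power2_eq_square)
  with split N_le show "(norm (F y - z))^2 + (1 - \<alpha>) / \<alpha> * (norm (F y - y))^2 \<le> (norm (y - z))^2"
    by (simp add: algebra_simps)
qed

section \<open>Convergence of the iterates\<close>

lemma closed_fixed_points:
  fixes F :: "'a::real_normed_vector \<Rightarrow> 'a"
  assumes "continuous_on UNIV F"
  shows "closed (fixed_points F)"
  unfolding fixed_points_def using assms by (intro closed_Collect_eq) auto

lemma sufficient_decrease_iterates_decseq:
  assumes "sufficient_decrease c F" "0 \<le> c" "z \<in> fixed_points F" "\<And>k. x (Suc k) = F (x k)"
  shows "decseq (\<lambda>k. norm (x k - z))"
  using sufficient_decrease_norm_le[OF assms(1-3)] by (auto simp: decseq_Suc_iff assms(4))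

lemma sufficient_decrease_residual_tendsto_0:
  assumes "sufficient_decrease c F" "0 < c" "z \<in> fixed_points F" "\<And>k. x (Suc k) = F (x k)"
  shows "(\<lambda>k. F (x k) - x k) \<longlonglongrightarrow> 0"
proof -
  define a where "a k = (norm (x k - z))^2" for k
  have "decseq (\<lambda>k. norm (x k - z))"
    using sufficient_decrease_iterates_decseq assms by (metis less_imp_le)
  then have "decseq a"
    unfolding a_def decseq_def by (auto intro: power_mono)
  then obtain L where L: "a \<longlonglongrightarrow> L"
    using decseq_convergent[of a 0] unfolding a_def by auto
  have "(\<lambda>k. (a k - a (Suc k)) / c) \<longlonglongrightarrow> (L - L) / c"
    using assms(2) by (intro tendsto_intros L LIMSEQ_Suc) auto
  then have lim: "(\<lambda>k. (a k - a (Suc k)) / c) \<longlonglongrightarrow> 0"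
    by simp
  have bound: "(norm (F (x k) - x k))^2 \<le> (a k - a (Suc k)) / c" for k
    using sufficient_decreaseD[OF assms(1,3), of "x k"] assms(2)
    by (simp add: a_def assms(4) field_simps)
  have "(\<lambda>k. (norm (F (x k) - x k))^2) \<longlonglongrightarrow> 0"
    by (rule tendsto_sandwich[OF _ _ tendsto_const lim]) (use bound in auto)
  then have "(\<lambda>k. sqrt ((norm (F (x k) - x k))^2)) \<longlonglongrightarrow> sqrt 0"
    by (rule tendsto_real_sqrt)
  then show ?thesis
    by (simp add: tendsto_norm_zero_iff)
qed

lemma sufficient_decrease_iterates_converge:
  fixes F :: "'a::euclidean_space \<Rightarrow> 'a"
  assumes "sufficient_decrease c F" "0 < c" "continuous_on UNIV F" "fixed_points F \<noteq> {}"
    and x: "\<And>k. x (Suc k) = F (x k)"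
  obtains p where "p \<in> fixed_points F" "x \<longlonglongrightarrow> p"
proof -
  obtain z where z: "z \<in> fixed_points F"
    using assms(4) by blast
  have dec: "decseq (\<lambda>k. norm (x k - w))" if "w \<in> fixed_points F" for w
    using sufficient_decrease_iterates_decseq[where x = x, OF assms(1) _ that x] assms(2) by simp
  have "\<forall>k. x k \<in> cball z (norm (x 0 - z))"
    using dec[OF z] by (auto simp: decseq_def dist_norm norm_minus_commute[of z])
  then obtain p r where r: "strict_mono r" and p: "(x \<circ> r) \<longlonglongrightarrow> p"
    using seq_compactE[OF compact_imp_seq_compact[OF compact_cball]] by metis
  have "(\<lambda>k. F ((x \<circ> r) k)) \<longlonglongrightarrow> F p"
    using continuous_on_tendsto_compose[OF assms(3) p] by simp
  then have "(\<lambda>k. F ((x \<circ> r) k) - (x \<circ> r) k) \<longlonglongrightarrow> F p - p"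
    using p by (intro tendsto_diff)
  moreover have "(\<lambda>k. F ((x \<circ> r) k) - (x \<circ> r) k) \<longlonglongrightarrow> 0"
    using LIMSEQ_subseq_LIMSEQ[OF sufficient_decrease_residual_tendsto_0[where x = x, OF assms(1,2) z x] r]
    by (simp add: o_def)
  ultimately have fixed: "p \<in> fixed_points F"
    using LIMSEQ_unique by (fastforce simp: fixed_points_def)
  \<comment> \<open>a monotone real sequence inherits the limit of any of its subsequences\<close>
  obtain L where L: "(\<lambda>k. norm (x k - p)) \<longlonglongrightarrow> L"
    using decseq_convergent[OF dec[OF fixed], of 0] by auto
  have "(\<lambda>k. norm ((x \<circ> r) k - p)) \<longlonglongrightarrow> 0"
    using tendsto_norm_zero[OF LIM_zero[OF p]] .
  moreover have "(\<lambda>k. norm ((x \<circ> r) k - p)) \<longlonglongrightarrow> L"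
    using LIMSEQ_subseq_LIMSEQ[OF L r] by (simp add: o_def)
  ultimately have "L = 0"
    using LIMSEQ_unique by blast
  with L have "x \<longlonglongrightarrow> p"
    by (simp add: LIM_zero_iff tendsto_norm_zero_iff)
  with fixed show ?thesis
    by (rule that)
qed

section \<open>Consequences of the error bound\<close>

lemma error_bound_residual:
  assumes "error_bound F R K" "0 < K" "infdist y (fixed_points F) \<le> R"
  shows "(infdist y (fixed_points F))^2 / K^2 \<le> (norm (F y - y))^2"
proof -
  have "infdist y (fixed_points F) \<le> K * norm (F y - y)"
    using assms(1,3) unfolding error_bound_def by blast
  then have "infdist y (fixed_points F) / K \<le> norm (F y - y)"
    using assms(2) by (simp add: field_simps)
  then have "(infdist y (fixed_points F) / K)^2 \<le> (norm (F y - y))^2"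
    using assms(2) by (intro power_mono) (auto simp: infdist_nonneg)
  then show ?thesis
    by (simp add: power_divide)
qed

text \<open>
  The witness \<open>z\<close> is exposed because the contraction is needed towards the point \<open>z\<close> itself, and not
  only for the distance to the set: it is how the limit of the orbit is located.
\<close>

lemma error_bound_contracts_to_nearest:
  fixes F :: "'a::euclidean_space \<Rightarrow> 'a"
  assumes "sufficient_decrease c F" "0 \<le> c" "continuous_on UNIV F" "fixed_points F \<noteq> {}"
    and "error_bound F R K" "0 < K" "infdist y (fixed_points F) \<le> R"
  obtains z where "z \<in> fixed_points F" "norm (y - z) = infdist y (fixed_points F)"
    "(norm (F y - z))^2 \<le> (1 - c / K^2) * (infdist y (fixed_points F))^2"
proof -
  let ?d = "infdist y (fixed_points F)"
  obtain z where z: "z \<in> fixed_points F" "?d = dist y z"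
    using infdist_attains_inf[OF closed_fixed_points[OF assms(3)] assms(4)] by blast
  have "c * (?d^2 / K^2) \<le> c * (norm (F y - y))^2"
    using error_bound_residual[OF assms(5-7)] assms(2) by (rule mult_left_mono)
  then have "(norm (F y - z))^2 \<le> (1 - c / K^2) * ?d^2"
    using sufficient_decreaseD[OF assms(1) z(1), of y] z(2) by (simp add: dist_norm algebra_simps)
  with z show ?thesis
    by (intro that) (auto simp: dist_norm)
qed

text \<open>
  Points on the segment from a nearest point \<open>z\<close> of \<open>S\<close> to \<open>y\<close> still have \<open>z\<close> as a nearest point, so
  their distances to \<open>S\<close> take every value between \<open>0\<close> and that of \<open>y\<close>.
\<close>

lemma exists_small_positive_infdist:
  fixes S :: "'a::euclidean_space set"
  assumes "closed S" "S \<noteq> {}" "S \<noteq> UNIV" "0 < R"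
  obtains y where "0 < infdist y S" "infdist y S \<le> R"
proof -
  obtain w where w: "w \<notin> S"
    using assms(3) by blast
  obtain z where z: "z \<in> S" "infdist w S = dist w z"
    using infdist_attains_inf[OF assms(1,2)] by blast
  have wz: "0 < norm (w - z)"
    using w z(1) by auto
  define s where "s = min 1 (R / norm (w - z))"
  define y where "y = z + s *\<^sub>R (w - z)"
  have s: "0 < s" "s \<le> 1" "s * norm (w - z) \<le> R"
    using assms(4) wz by (auto simp: s_def min_def field_simps split: if_splits)
  have "dist y z = s * norm (w - z)"
    using s by (simp add: y_def dist_norm)
  then have "infdist y S \<le> s * norm (w - z)"
    using infdist_le[OF z(1), of y] by simp
  then have "infdist y S \<le> R"
    using s by linarith
  moreover have "0 < infdist y S"
  proof -
    have "w - y = (1 - s) *\<^sub>R (w - z)"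
      by (simp add: y_def algebra_simps)
    then have "dist w y = (1 - s) * norm (w - z)"
      using s by (simp add: dist_norm)
    moreover have "infdist w S \<le> infdist y S + dist w y"
      by (rule infdist_triangle)
    moreover have "infdist w S = norm (w - z)"
      using z by (simp add: dist_norm)
    ultimately have "s * norm (w - z) \<le> infdist y S"
      by (simp add: algebra_simps)
    moreover have "0 < s * norm (w - z)"
      using s wz by simp
    ultimately show ?thesis
      by linarith
  qed
  ultimately show ?thesis
    by (rule that[rotated])
qed

lemma error_bound_radicand_nonneg:
  fixes F :: "'a::euclidean_space \<Rightarrow> 'a"
  assumes "sufficient_decrease c F" "0 \<le> c" "continuous_on UNIV F" "fixed_points F \<noteq> {}"
    and "error_bound F R K" "0 < K" "0 < R" "F \<noteq> id"
  shows "0 \<le> 1 - c / K^2"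
proof -
  have "fixed_points F \<noteq> UNIV"
    using assms(8) by (auto simp: fixed_points_def fun_eq_iff)
  then obtain y where y: "0 < infdist y (fixed_points F)" "infdist y (fixed_points F) \<le> R"
    using exists_small_positive_infdist[OF closed_fixed_points[OF assms(3)] assms(4)] assms(7)
    by blast
  obtain z where "(norm (F y - z))^2 \<le> (1 - c / K^2) * (infdist y (fixed_points F))^2"
    using error_bound_contracts_to_nearest[OF assms(1-6) y(2)] by blast
  then have "0 \<le> (1 - c / K^2) * (infdist y (fixed_points F))^2"
    using zero_le_power2 order_trans by blast
  then show ?thesis
    using y(1) by (simp add: zero_le_mult_iff)
qed

section \<open>The two rates\<close>

lemma sqrt_one_minus_le:
  fixes t :: real
  assumes "t \<le> 1"
  shows "sqrt (1 - t) \<le> 1 - t / 2"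
proof (rule real_le_lsqrt)
  have "(1 - t / 2)^2 = 1 - t + (t / 2)^2"
    by (simp add: power2_eq_square algebra_simps)
  then show "1 - t \<le> (1 - t / 2)^2"
    using zero_le_power2[of "t / 2"] by linarith
qed (use assms in auto)

lemma rate_decrement_bounds:
  fixes r :: real
  assumes "0 \<le> r" "r < 1"
  shows "0 < (1 + r) / 2 * (1 - r)^2" "(1 + r) / 2 * (1 - r)^2 \<le> 1"
proof -
  show "0 < (1 + r) / 2 * (1 - r)^2"
    using assms by simp
  have "(1 + r) / 2 * (1 - r)^2 \<le> 1 * 1"
    using assms by (intro mult_mono power_le_one) auto
  then show "(1 + r) / 2 * (1 - r)^2 \<le> 1"
    by simp
qed

text \<open>
  Since \<open>1 - r\<^sup>2 = t\<close>, the amount subtracted under the root is \<open>t (1 - r) / 2\<close>, and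
  \<open>1 - r \<ge> t / 2\<close>; the root is then at most \<open>1 - t\<^sup>2 / 8\<close>.
\<close>

lemma limit_rate_le:
  fixes t :: real
  assumes "0 < t" "t \<le> 1" and r: "r = sqrt (1 - t)"
  shows "sqrt (1 - (1 + r) / 2 * (1 - r)^2) \<le> 1 - t^2 / 16"
proof -
  let ?e = "(1 + r) / 2 * (1 - r)^2"
  have r01: "0 \<le> r" "r < 1"
    using assms by auto
  have "r^2 = 1 - t"
    using assms by simp
  then have t: "(1 + r) * (1 - r) = t"
    by (simp add: power2_eq_square algebra_simps)
  have "?e = ((1 + r) * (1 - r)) * (1 - r) / 2"
    by (simp add: power2_eq_square)
  then have e: "?e = t * (1 - r) / 2"
    by (simp only: t)
  have "t / 2 \<le> 1 - r"
    using sqrt_one_minus_le[OF assms(2)] r by linarith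
  then have "t * (t / 2) \<le> t * (1 - r)"
    using assms(1) by (intro mult_left_mono) auto
  then have "t^2 / 8 \<le> ?e / 2"
    unfolding e by (simp add: power2_eq_square)
  moreover have "sqrt (1 - ?e) \<le> 1 - ?e / 2"
    using rate_decrement_bounds[OF r01] by (intro sqrt_one_minus_le)
  moreover have "0 \<le> t^2"
    by simp
  ultimately show ?thesis
    by linarith
qed

text \<open>
  Here \<open>m\<close> is the distance of a point to the limit \<open>p\<close> of its orbit, \<open>d\<close> its distance to the set of
  fixed points. The slack in \<open>(1 + r)\<^sup>2 (1 - r) \<le> 2\<close> is what lets the
  decrease \<open>(1 - r\<^sup>2) d\<^sup>2\<close> absorb that multiple of \<open>m\<^sup>2\<close>.
\<close>

lemma rate_decrement_absorbed:
  fixes r d m :: real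
  assumes "0 \<le> r" "r < 1" "0 \<le> m" "m \<le> (1 + r) * d"
  shows "(1 + r) / 2 * (1 - r)^2 * m^2 \<le> (1 - r^2) * d^2"
proof -
  have "(1 + r)^2 * (1 - r) = 1 + r - r^2 - r^3"
    by (simp add: power2_eq_square power3_eq_cube algebra_simps)
  moreover have "0 \<le> r^2" "0 \<le> r^3"
    using assms(1) by simp_all
  ultimately have two: "(1 + r)^2 * (1 - r) \<le> 2"
    using assms(2) by linarith
  have "m^2 \<le> (1 + r)^2 * d^2"
    using power_mono[OF assms(4,3), of 2] by (simp add: power_mult_distrib)
  then have "(1 + r) / 2 * (1 - r)^2 * m^2 \<le> (1 + r) / 2 * (1 - r)^2 * ((1 + r)^2 * d^2)"
    using assms by (intro mult_left_mono) auto
  also have "\<dots> = ((1 + r)^2 * (1 - r)) * ((1 + r) * (1 - r) * d^2 / 2)"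
    by (simp add: power2_eq_square)
  also have "\<dots> \<le> 2 * ((1 + r) * (1 - r) * d^2 / 2)"
    using assms by (intro mult_right_mono[OF two]) auto
  also have "\<dots> = (1 - r^2) * d^2"
    by (simp add: power2_eq_square field_simps)
  finally show ?thesis .
qed

lemma error_bound_infdist_contracts:
  fixes F :: "'a::euclidean_space \<Rightarrow> 'a"
  assumes "sufficient_decrease c F" "0 \<le> c" "continuous_on UNIV F" "fixed_points F \<noteq> {}"
    and "error_bound F R K" "0 < K" "infdist y (fixed_points F) \<le> R"
    and r: "r = sqrt (1 - c / K^2)"
  shows "infdist (F y) (fixed_points F) \<le> r * infdist y (fixed_points F)"
proof -
  obtain z where z: "z \<in> fixed_points F"
    "(norm (F y - z))^2 \<le> (1 - c / K^2) * (infdist y (fixed_points F))^2"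
    using error_bound_contracts_to_nearest[OF assms(1-7)] by blast
  have "norm (F y - z) \<le> sqrt ((1 - c / K^2) * (infdist y (fixed_points F))^2)"
    using z(2) by (rule real_le_rsqrt)
  also have "\<dots> = r * infdist y (fixed_points F)"
    by (simp add: r real_sqrt_mult infdist_nonneg)
  finally show ?thesis
    using infdist_le[OF z(1), of "F y"] by (simp add: dist_norm)
qed

text \<open>
  A single application of the error bound, at \<open>x k\<close>, suffices: it places \<open>x (Suc k)\<close> within \<open>r d\<close> of
  the point \<open>z\<close> nearest to \<open>x k\<close>, and monotonicity of the distance to \<open>z\<close> keeps all later iterates,
  hence \<open>p\<close>, within \<open>r d\<close> of \<open>z\<close>.
\<close>

lemma error_bound_limit_contracts:
  fixes F :: "'a::euclidean_space \<Rightarrow> 'a"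
  assumes "sufficient_decrease c F" "0 < c" "continuous_on UNIV F"
    and "error_bound F R K" "0 < K"
    and x: "\<And>k. x (Suc k) = F (x k)"
    and p: "p \<in> fixed_points F" "x \<longlonglongrightarrow> p"
    and close: "infdist (x k) (fixed_points F) \<le> R"
    and nonneg: "0 \<le> 1 - c / K^2" and r: "r = sqrt (1 - c / K^2)"
  shows "norm (x (Suc k) - p) \<le> sqrt (1 - (1 + r) / 2 * (1 - r)^2) * norm (x k - p)"
proof -
  let ?d = "infdist (x k) (fixed_points F)"
  let ?e = "(1 + r) / 2 * (1 - r)^2"
  have c0: "0 \<le> c" and ne: "fixed_points F \<noteq> {}"
    using assms(2) p(1) by auto
  have r01: "0 \<le> r" "r < 1" and r2: "r^2 = 1 - c / K^2"
    using nonneg assms(2,5) by (auto simp: r)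
  obtain z where z: "z \<in> fixed_points F" "norm (x k - z) = ?d"
    "(norm (F (x k) - z))^2 \<le> (1 - c / K^2) * ?d^2"
    using error_bound_contracts_to_nearest[OF assms(1) c0 assms(3) ne assms(4,5) close] by blast
  have "(norm (x (Suc k) - z))^2 \<le> (r * ?d)^2"
    using z(3) by (simp add: x r2 power_mult_distrib)
  then have step: "norm (x (Suc k) - z) \<le> r * ?d"
    by (rule power2_le_imp_le) (simp add: infdist_nonneg r01)
  have "norm (x j - z) \<le> r * ?d" if "Suc k \<le> j" for j
    using decseqD[OF sufficient_decrease_iterates_decseq[where x = x, OF assms(1) c0 z(1) x] that]
      step by linarith
  then have "norm (p - z) \<le> r * ?d"
    using p(2) by (intro LIMSEQ_le_const2[OF tendsto_norm[OF tendsto_diff[OF p(2) tendsto_const]]])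
      blast
  then have "norm (x k - p) \<le> (1 + r) * ?d"
    using norm_triangle_ineq[of "x k - z" "z - p"] z(2)
    by (simp add: norm_minus_commute[of z] algebra_simps)
  then have "?e * (norm (x k - p))^2 \<le> (1 - r^2) * ?d^2"
    using r01 by (intro rate_decrement_absorbed) auto
  also have "\<dots> = c * (?d^2 / K^2)"
    by (simp add: r2)
  also have "\<dots> \<le> c * (norm (F (x k) - x k))^2"
    using error_bound_residual[OF assms(4,5) close] c0 by (rule mult_left_mono)
  finally have "(norm (x (Suc k) - p))^2 \<le> (1 - ?e) * (norm (x k - p))^2"
    using sufficient_decreaseD[OF assms(1) p(1), of "x k"]
    unfolding x left_diff_distrib by linarith
  then have "norm (x (Suc k) - p) \<le> sqrt ((1 - ?e) * (norm (x k - p))^2)"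
    by (rule real_le_rsqrt)
  then show ?thesis
    by (simp add: real_sqrt_mult)
qed

section \<open>Linear convergence\<close>

theorem theorem2:
  fixes F :: "real ^ 'n \<Rightarrow> real ^ 'n"
    and x :: "nat \<Rightarrow> real ^ 'n"
    and \<alpha> R K \<rho> \<rho>' :: real
  assumes "0 < \<alpha>" and "\<alpha> < 1"
    and "continuous_on UNIV F"
    and "averaged \<alpha> F"
    and "fixed_points F \<noteq> {}"
    and "0 < R" and "0 < K"
    and "error_bound F R K"
    and "\<And>k. x (Suc k) = F (x k)"
    and "\<rho> = sqrt (1 - (1 - \<alpha>) / (\<alpha> * K^2))"
    and "\<rho>' = sqrt (1 - (1 + \<rho>) / 2 * (1 - \<rho>)^2)"
  shows "\<exists>xbar \<in> fixed_points F.
           converges_linearly x xbar \<and>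
           (\<forall>k. infdist (x k) (fixed_points F) \<le> R \<longrightarrow>
              infdist (x (Suc k)) (fixed_points F) \<le> \<rho> * infdist (x k) (fixed_points F) \<and>
              norm (x (Suc k) - xbar) \<le> \<rho>' * norm (x k - xbar)) \<and>
           (F \<noteq> id \<longrightarrow> 0 \<le> 1 - (1 - \<alpha>) / (\<alpha> * K^2)) \<and>
           (0 \<le> 1 - (1 - \<alpha>) / (\<alpha> * K^2) \<longrightarrow>
              \<rho> \<le> 1 - (1 - \<alpha>) / (2 * \<alpha> * K^2) \<and>
              \<rho>' \<le> 1 - (1 - \<alpha>)^2 / (16 * \<alpha>^2 * K^4))"
proof -
  define c where "c = (1 - \<alpha>) / \<alpha>"
  let ?S = "fixed_points F"
  have c: "0 < c"
    using assms(1,2) by (simp add: c_def)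
  have c_K: "(1 - \<alpha>) / (\<alpha> * K^2) = c / K^2"
    by (simp add: c_def)
  have dec: "sufficient_decrease c F"
    using averaged_sufficient_decrease[OF assms(4,1)] by (simp add: c_def)
  have \<rho>: "\<rho> = sqrt (1 - c / K^2)"
    using assms(10) c_K by simp
  obtain p where p: "p \<in> ?S" "x \<longlonglongrightarrow> p"
    using sufficient_decrease_iterates_converge[where x = x, OF dec c assms(3,5,9)] by blast
  have stationary: "x k = p" if "F = id" for k
  proof -
    have "x j = x 0" for j
      by (induction j) (simp_all add: assms(9) that)
    then have "x = (\<lambda>j. x 0)"
      by (rule ext)
    with p(2) show ?thesis
      by (metis LIMSEQ_const_iff)
  qed
  have nonneg: "0 \<le> 1 - c / K^2" if "F \<noteq> id"
    using error_bound_radicand_nonneg[OF dec _ assms(3,5,8,7,6) that] c by simp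
  have dist_rate: "infdist (x (Suc k)) ?S \<le> \<rho> * infdist (x k) ?S" if "infdist (x k) ?S \<le> R" for k
    using error_bound_infdist_contracts[OF dec _ assms(3,5,8,7) that \<rho>] c assms(9) by simp
  have limit_rate: "norm (x (Suc k) - p) \<le> \<rho>' * norm (x k - p)" if "infdist (x k) ?S \<le> R" for k
  proof (cases "F = id")
    case True
    then show ?thesis
      by (simp add: stationary)
  next
    case False
    show ?thesis
      using error_bound_limit_contracts[where x = x, OF dec c assms(3,8,7,9) p that nonneg[OF False] \<rho>] assms(11)
      by simp
  qed
  have linear: "converges_linearly x p"
  proof (cases "F = id")
    case True
    with p(2) show ?thesis
      unfolding converges_linearly_def by (auto simp: stationary intro!: exI[of _ 0])
  next
    case False
    have "0 \<le> \<rho>" "\<rho> < 1"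
      using nonneg[OF False] c assms(7) by (auto simp: \<rho>)
    then have q: "0 \<le> \<rho>'" "\<rho>' < 1"
      using rate_decrement_bounds[of \<rho>] by (auto simp: assms(11))
    have "(\<lambda>k. infdist (x k) ?S) \<longlonglongrightarrow> infdist p ?S"
      using p(2) by (rule tendsto_infdist)
    then have "(\<lambda>k. infdist (x k) ?S) \<longlonglongrightarrow> 0"
      using p(1) by simp
    then have "\<forall>\<^sub>F k in sequentially. infdist (x k) ?S < R"
      using assms(6) by (rule order_tendstoD)
    then obtain k0 where "\<And>k. k \<ge> k0 \<Longrightarrow> infdist (x k) ?S < R"
      unfolding eventually_sequentially by blast
    then have "\<forall>k\<ge>k0. norm (x (Suc k) - p) \<le> \<rho>' * norm (x k - p)"
      using limit_rate less_imp_le by blast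
    with p(2) q show ?thesis
      unfolding converges_linearly_def by blast
  qed
  have closed_forms: "\<rho> \<le> 1 - (1 - \<alpha>) / (2 * \<alpha> * K^2) \<and> \<rho>' \<le> 1 - (1 - \<alpha>)^2 / (16 * \<alpha>^2 * K^4)"
    if "0 \<le> 1 - c / K^2"
  proof -
    let ?t = "c / K^2"
    have t: "0 < ?t" "?t \<le> 1"
      using that c assms(7) by auto
    have "(1 - \<alpha>) / (2 * \<alpha> * K^2) = ?t / 2" "(1 - \<alpha>)^2 / (16 * \<alpha>^2 * K^4) = ?t^2 / 16"
      by (simp_all add: c_def power_divide power_mult[symmetric] algebra_simps)
    then show ?thesis
      using sqrt_one_minus_le[OF t(2)] limit_rate_le[OF t \<rho>] \<rho> assms(11) by simp
  qed
  show ?thesis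
    unfolding c_K using p(1) linear dist_rate limit_rate nonneg closed_forms by blast
qed

end
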